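(* Let $n\ge 3$ and ${\boldsymbol y}\in\{0,1\}^{n-2}$ with run length profile $(r_1,\dots,r_R)$ and alternating-segment length profile $(a_1,\dots,a_A)$. Then $$\mathsf{H}^{\mathsf{In}}_{2\text{-}\mathsf{Del}}({\boldsymbol y})=\log_2\big(2n(n-1)\big)-\frac{W({\boldsymbol y})}{2n(n-1)},$$ where $W({\boldsymbol y})=\sum_{{\boldsymbol x}\in\{0,1\}^n}\omega_{{\boldsymbol y}}({\boldsymbol x})\log_2\omega_{{\boldsymbol y}}({\boldsymbol x})$ (terms with $\omega_{{\boldsymbol y}}({\boldsymbol x})=0$ omitted) equals $$\sum_{i=1}^{R}\mathcal F\!\left(\binom{r_i+2}{2}\right)+\sum_{1\le i<j\le R}\mathcal F\big((r_i+1)(r_j+1)\big)+\sum_{i=1}^{R}(n+1-R-r_i)\,\mathcal F(r_i+1)$$ $$+\sum_{i=1}^{A}\mathcal F\!\left(1+\sum_{j=b_i}^{f_i}a_j-(a_{b_i}-1)\mathbb I_{b_i\ne i}-(a_{f_i}-1)\mathbb I_{f_i\ne i}\right),$$ with $\mathcal F(a)=a\log_2 a$.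
   Context: For binary sequences ${\boldsymbol x}$ of length $N$ and ${\boldsymbol y}$ of length $\ell\le N$, $\omega_{{\boldsymbol y}}({\boldsymbol x})$ is the number of index tuples $1\le i_1<\dots<i_\ell\le N$ with $x_{i_j}=y_j$. The $k$-deletion channel with input length $n$ maps ${\boldsymbol x}\in\{0,1\}^n$ to ${\boldsymbol y}\in\{0,1\}^{n-k}$ with probability $\omega_{{\boldsymbol y}}({\boldsymbol x})/\binom nk$; under uniform transmission ($X$ uniform on $\{0,1\}^n$), $\mathsf{H}^{\mathsf{In}}_{k\text{-}\mathsf{Del}}({\boldsymbol y})=H(X\mid Y={\boldsymbol y})$ in bits, with posterior $P({\boldsymbol x}\mid {\boldsymbol y})=\Pr\{{\boldsymbol y}\mid{\boldsymbol x}\}/\sum_{{\boldsymbol x}'}\Pr\{{\boldsymbol y}\mid{\boldsymbol x}'\}$. A run is a maximal block of identical consecutive symbols; $(r_1,\dots,r_R)$ are the run lengths from left to right. An alternating segment of ${\boldsymbol y}$ is a contiguous substring in which any two consecutive symbols differ; it is maximal if it cannot be extended to the left or right within ${\boldsymbol y}$. $(a_1,\dots,a_A)$ are the lengths of the maximal alternating segments of ${\boldsymbol y}$ from left to right ($A$ is their number). For $i\in[1,A-1]$, $f_i$ is the smallest $j\in[i+1,A]$ with $a_j>1$, or $A$ if no such $j$ exists; $f_A=A$. For $i\in[2,A]$, $b_i$ is the largest $j\in[1,i-1]$ with $a_j>1$, or $1$ if no such $j$ exists; $b_1=1$. $\mathbb I$ is the indicator function. *)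

theory Defs
  imports Complex_Main
begin

text \<open>Binary sequences are modelled as bool lists. Indices of subsequence embeddings are
0-based sets of positions; the embedding count omega_y(x) is the number of index sets I
of size |y| inside the positions of x such that the subsequence of x at I equals y.\<close>

definition omega :: "bool list \<Rightarrow> bool list \<Rightarrow> nat" where
  "omega y x = card {I. I \<subseteq> {..<length x} \<and> card I = length y \<and> nths x I = y}"

definition del_prob :: "nat \<Rightarrow> nat \<Rightarrow> bool list \<Rightarrow> bool list \<Rightarrow> real" where
  "del_prob n k x y = real (omega y x) / real (n choose k)"

text \<open>Posterior P(x | y) under uniform input on {0,1}^n.\<close>
definition posterior :: "nat \<Rightarrow> nat \<Rightarrow> bool list \<Rightarrow> bool list \<Rightarrow> real" where
  "posterior n k y x =
     del_prob n k x y / (\<Sum>x'\<in>{x'. length x' = n}. del_prob n k x' y)"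

definition H_in_del :: "nat \<Rightarrow> nat \<Rightarrow> bool list \<Rightarrow> real" where
  "H_in_del n k y =
     - (\<Sum>x\<in>{x. length x = n}.
          (if posterior n k y x = 0 then 0
           else posterior n k y x * log 2 (posterior n k y x)))"

definition F :: "real \<Rightarrow> real" where
  "F a = a * log 2 a"

definition W :: "nat \<Rightarrow> bool list \<Rightarrow> real" where
  "W n y = (\<Sum>x\<in>{x. length x = n}.
              (if omega y x = 0 then 0 else F (real (omega y x))))"

fun runs :: "'a list \<Rightarrow> nat list" where
  "runs [] = []"
| "runs [x] = [1]"
| "runs (x # z # xs) =
     (let r = runs (z # xs) in if x = z then Suc (hd r) # tl r else 1 # r)"

fun alts :: "'a list \<Rightarrow> nat list" where
  "alts [] = []"
| "alts [x] = [1]"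
| "alts (x # z # xs) =
     (let r = alts (z # xs) in if x \<noteq> z then Suc (hd r) # tl r else 1 # r)"

definition idx :: "nat list \<Rightarrow> nat \<Rightarrow> nat" where
  "idx l i = l ! (i - 1)"

definition f_idx :: "nat list \<Rightarrow> nat \<Rightarrow> nat" where
  "f_idx a i =
     (if \<exists>j. i + 1 \<le> j \<and> j \<le> length a \<and> idx a j > 1
      then LEAST j. i + 1 \<le> j \<and> j \<le> length a \<and> idx a j > 1
      else length a)"

definition b_idx :: "nat list \<Rightarrow> nat \<Rightarrow> nat" where
  "b_idx a i =
     (if \<exists>j. 1 \<le> j \<and> j \<le> i - 1 \<and> idx a j > 1
      then GREATEST j. 1 \<le> j \<and> j \<le> i - 1 \<and> idx a j > 1
      else 1)"

end

theory Submission
  imports Defs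
begin

text \<open>The entropy formula follows from \<open>\<Sum>\<^sub>x \<omega>\<^sub>y(x) = (n choose 2) \<cdot> 4\<close>. For \<open>W\<close>, replace
\<open>\<F>\<close> by an arbitrary \<open>G\<close> with \<open>G 0 = G 1 = 0\<close> and read the words \<open>x\<close> from the left along \<open>y\<close>. As long as \<open>x\<close> agrees with
\<open>y\<close>, the embedding count of \<open>x\<close> is a combination of embedding counts of the remainders, determined
by the number \<open>s\<close> of letters already read in the current run and by a correction \<open>e\<close> for the single
word that inserts an alternating pair. When \<open>x\<close> leaves \<open>y\<close>, only one inserted letter is left and the
counts are those of single insertions: \<open>r + 1\<close> if a run of length \<open>r\<close> is extended, 1 if a new run is
created. The correction \<open>e\<close> grows along runs of length 1 and is reset by longer runs, which gives
the sum over the maximal alternating segments.\<close>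

section \<open>Recursion for embedding counts\<close>

lemma omega_nths: "omega y x = card {I. I \<subseteq> {..<length x} \<and> nths x I = y}"
proof -
  have "card I = length (nths x I)" if "I \<subseteq> {..<length x}" for I
  proof -
    have "{i. i < length x \<and> i \<in> I} = I" using that by auto
    then show ?thesis by (simp add: length_nths)
  qed
  then show ?thesis unfolding omega_def by (metis (mono_tags, lifting))
qed

lemma omega_Nil_right: "omega y [] = of_bool (y = [])"
proof -
  have "{I. I \<subseteq> {..<length ([]::bool list)} \<and> nths [] I = y} = (if y = [] then {{}} else {})"
    by auto
  then show ?thesis by (simp add: omega_nths)
qed

text \<open>Split the index sets by whether they contain position 0 and shift the other positions
  down by one. Keeping \<open>c # nths x I = y\<close> covers the empty \<open>y\<close>
  too.\<close>

lemma omega_Cons_right: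
  "omega y (c # x) = omega y x + card {I. I \<subseteq> {..<length x} \<and> c # nths x I = y}"
proof -
  let ?S = "{I. I \<subseteq> {..<length x} \<and> nths x I = y}"
  let ?T = "{I. I \<subseteq> {..<length x} \<and> c # nths x I = y}"
  have pre: "{j. Suc j \<in> Suc ` I} = I" "{j. Suc j \<in> insert 0 (Suc ` I)} = I" for I
    by auto
  have "{I. I \<subseteq> {..<length (c # x)} \<and> nths (c # x) I = y}
      = (`) Suc ` ?S \<union> (\<lambda>I. insert 0 (Suc ` I)) ` ?T" (is "?L = ?R")
  proof
    show "?R \<subseteq> ?L" by (auto simp: nths_Cons pre)
    show "?L \<subseteq> ?R"
    proof
      fix I assume "I \<in> ?L"
      then have I: "I \<subseteq> {..<Suc (length x)}" "nths (c # x) I = y" by auto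
      let ?J = "{j. Suc j \<in> I}"
      have J: "?J \<subseteq> {..<length x}" using I(1) by auto
      have "I = (if 0 \<in> I then insert 0 (Suc ` ?J) else Suc ` ?J)"
        by (auto simp: image_iff) (metis not0_implies_Suc)+
      then show "I \<in> ?R" using I(2) J by (auto simp: nths_Cons split: if_splits)
    qed
  qed
  moreover have "card ((`) Suc ` ?S) = card ?S"
    by (intro card_image inj_onI) (metis pre(1))
  moreover have "card ((\<lambda>I. insert 0 (Suc ` I)) ` ?T) = card ?T"
    by (intro card_image inj_onI) (metis pre(2))
  moreover have "finite ?S" "finite ?T" by auto
  moreover have "(`) Suc ` ?S \<inter> (\<lambda>I. insert 0 (Suc ` I)) ` ?T = {}" by auto
  ultimately show ?thesis by (simp add: omega_nths card_Un_disjoint)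
qed

lemma omega_Nil: "omega [] x = 1"
  by (induction x) (auto simp: omega_Nil_right omega_Cons_right)

lemma omega_Cons_Cons:
  "omega (b # y) (c # x) = omega (b # y) x + (if b = c then omega y x else 0)"
  unfolding omega_Cons_right by (simp add: omega_nths)

lemma omega_eq_0: "length x < length y \<Longrightarrow> omega y x = 0"
proof (induction x arbitrary: y)
  case Nil
  then show ?case by (auto simp: omega_Nil_right)
next
  case (Cons c x)
  then show ?case by (cases y) (auto simp: omega_Cons_Cons)
qed

lemma omega_same_length: "length x = length y \<Longrightarrow> omega y x = of_bool (x = y)"
proof (induction x arbitrary: y)
  case Nil
  then show ?case by (auto simp: omega_Nil_right)
next
  case (Cons c x)
  then show ?case by (cases y) (auto simp: omega_Cons_Cons omega_eq_0)
qed

section \<open>Total number of embeddings\<close>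

abbreviation words :: "nat \<Rightarrow> bool list set" where
  "words k \<equiv> {v. length v = k}"

lemma finite_words: "finite (words k)"
  using finite_lists_length_eq[of "UNIV :: bool set" k] by simp

lemma sum_words_Suc:
  fixes f :: "bool list \<Rightarrow> 'a::comm_monoid_add"
  shows "(\<Sum>v\<in>words (Suc k). f v) = (\<Sum>v\<in>words k. f (d # v)) + (\<Sum>v\<in>words k. f ((\<not> d) # v))"
proof -
  have "words (Suc k) = (#) d ` words k \<union> (#) (\<not> d) ` words k"
    by (auto simp: length_Suc_conv image_iff)
  moreover have "(#) d ` words k \<inter> (#) (\<not> d) ` words k = {}" by auto
  ultimately have "(\<Sum>v\<in>words (Suc k). f v)
      = (\<Sum>v\<in>(#) d ` words k. f v) + (\<Sum>v\<in>(#) (\<not> d) ` words k. f v)"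
    by (simp add: sum.union_disjoint finite_words)
  then show ?thesis by (simp add: sum.reindex)
qed

text \<open>Splitting off the first letter of \<open>x\<close> turns the recursion of
  \<open>omega\<close> into Pascal's rule; the skipped letter has two values, whence the power of
  2.\<close>

lemma sum_omega: "(\<Sum>x\<in>words (length y + k). omega y x) = ((length y + k) choose k) * 2 ^ k"
proof (induction "length y + k" arbitrary: y k)
  case 0
  then show ?case by (simp add: omega_Nil)
next
  case (Suc m)
  show ?case
  proof (cases y)
    case Nil
    have "card (words k) = 2 ^ k"
      using card_lists_length_eq[of "UNIV :: bool set" k] by simp
    then show ?thesis using Nil by (simp add: omega_Nil)
  next
    case (Cons b z)
    have m: "m = length z + k" using Suc.hyps(2) Cons by simp
    have z: "(\<Sum>x\<in>words m. omega z x) = (m choose k) * 2 ^ k"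
      using Suc.hyps(1)[of z k] m by simp
    have y: "2 * (\<Sum>x\<in>words m. omega y x) = (if k = 0 then 0 else (m choose (k - 1)) * 2 ^ k)"
    proof (cases k)
      case 0
      then show ?thesis using m Cons by (simp add: omega_eq_0)
    next
      case (Suc j)
      then show ?thesis using Suc.hyps(1)[of y j] m Cons by simp
    qed
    have "(\<Sum>x\<in>words (Suc m). omega y x) = 2 * (\<Sum>x\<in>words m. omega y x) + (\<Sum>x\<in>words m. omega z x)"
      unfolding sum_words_Suc[where d = b] by (simp add: Cons omega_Cons_Cons sum.distrib)
    also have "\<dots> = (Suc m choose k) * 2 ^ k"
      unfolding y z by (cases k) (auto simp: algebra_simps)
    finally show ?thesis using Suc.hyps(2) by simp
  qed
qed

section \<open>Run lengths and single insertions\<close>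

lemma runs_nonempty: "runs (c # w) \<noteq> []"
  by (induction w arbitrary: c) (auto simp: Let_def)

lemma runs_ConsE:
  obtains q qs where "runs (c # w) = q # qs"
  using runs_nonempty[of c w] by (cases "runs (c # w)") auto

lemma sum_list_runs: "sum_list (runs w) = length w"
proof (induction w rule: runs.induct)
  case (3 x z xs)
  obtain q qs where "runs (z # xs) = q # qs" by (rule runs_ConsE)
  then show ?case using 3 by (simp add: Let_def)
qed auto

lemma runs_pos: "r \<in> set (runs w) \<Longrightarrow> r \<ge> 1"
proof (induction w arbitrary: r rule: runs.induct)
  case (3 x z xs)
  obtain q qs where "runs (z # xs) = q # qs" by (rule runs_ConsE)
  then show ?case using 3 by (auto simp: Let_def split: if_splits)
qed auto

definition sum_runs :: "(nat \<Rightarrow> real) \<Rightarrow> nat list \<Rightarrow> real" where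
  "sum_runs H rs = (\<Sum>r\<leftarrow>rs. H (r + 1))"

lemma sum_runs_simps [simp]:
  "sum_runs H [] = 0" "sum_runs H (r # rs) = H (r + 1) + sum_runs H rs"
  by (simp_all add: sum_runs_def)

text \<open>While \<open>v\<close> follows the first run, each matched letter adds one embedding to
  the only word that repeats the letter once more. The offset \<open>s\<close> accumulates these
  embeddings; a deviating first letter leaves a single word, with count 1.\<close>

lemma sum_single_insertion_Cons:
  fixes H :: "nat \<Rightarrow> real"
  assumes H0: "H 0 = 0" and "runs (c # w) = r # rs"
  shows "(\<Sum>v\<in>words (Suc (Suc (length w))). H (omega (c # w) v + s * of_bool (v = c # c # w)))
       = H (r + 1 + s) + sum_runs H rs + (real (length w) + 2 - real (length rs)) * H 1"
  using assms(2)
proof (induction w arbitrary: c s r rs)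
  case Nil
  then have "r = 1" "rs = []" by auto
  then show ?case
    by (simp add: sum_words_Suc[where d = c] omega_Cons_Cons omega_Nil_right omega_Nil H0)
next
  case (Cons b w)
  let ?w = "c # b # w"
  let ?k = "Suc (Suc (length w))"
  have neg: "(\<Sum>v\<in>words ?k. H (omega ?w ((\<not> c) # v) + s * of_bool ((\<not> c) # v = c # ?w))) = H 1"
  proof -
    have "(\<Sum>v\<in>words ?k. H (omega ?w ((\<not> c) # v) + s * of_bool ((\<not> c) # v = c # ?w)))
        = (\<Sum>v\<in>words ?k. if v = ?w then H 1 else 0)"
      by (intro sum.cong) (auto simp: omega_Cons_Cons[of _ "b # w"] omega_same_length H0)
    then show ?thesis by (simp add: finite_words)
  qed
  have pos: "H (omega ?w (c # v) + s * of_bool (c # v = c # ?w))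
      = H (omega (b # w) v + (s + 1) * of_bool (v = ?w))" if "v \<in> words ?k" for v
    using that by (auto simp: omega_Cons_Cons[of _ "b # w"] omega_same_length algebra_simps)
  have split: "(\<Sum>v\<in>words (Suc ?k). H (omega ?w v + s * of_bool (v = c # ?w)))
      = (\<Sum>v\<in>words ?k. H (omega (b # w) v + (s + 1) * of_bool (v = ?w))) + H 1"
    by (subst sum_words_Suc[where d = c]) (simp only: neg pos cong: sum.cong)
  obtain q qs where q: "runs (b # w) = q # qs" by (rule runs_ConsE)
  show ?case
  proof (cases "c = b")
    case True
    then have "r = Suc q" "rs = qs" using Cons.prems q by auto
    then show ?thesis using Cons.IH[OF q, of "s + 1"] split True by (simp add: algebra_simps)
  next
    case False
    \<comment> \<open>A new run begins, so \<open>s\<close> can no longer be passed on: the word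
      \<open>?w\<close> is taken out of the sum, its value changing from \<open>H 1\<close> to
      \<open>H (s + 2)\<close>.\<close>
    have om: "omega (b # w) ?w = 1" using False by (simp add: omega_Cons_Cons[of _ w] omega_same_length omega_eq_0)
    have "(\<Sum>v\<in>words ?k. H (omega (b # w) v + (s + 1) * of_bool (v = ?w)))
        = (\<Sum>v\<in>words ?k. H (omega (b # w) v) + (if v = ?w then H (s + 2) - H 1 else 0))"
      by (intro sum.cong) (auto simp: om)
    also have "\<dots> = (\<Sum>v\<in>words ?k. H (omega (b # w) v)) + H (s + 2) - H 1"
      by (simp add: sum.distrib finite_words)
    finally have "(\<Sum>v\<in>words ?k. H (omega (b # w) v + (s + 1) * of_bool (v = ?w)))
        = (\<Sum>v\<in>words ?k. H (omega (b # w) v)) + H (s + 2) - H 1" .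
    moreover have "r = 1" "rs = q # qs" using Cons.prems q False by auto
    ultimately show ?thesis
      using Cons.IH[OF q, of 0] split by (simp add: algebra_simps)
  qed
qed

text \<open>The terms \<open>H 1\<close> are kept because \<open>H\<close> will also be
  \<open>G\<close> with its argument scaled by \<open>s + 1\<close>, which need not vanish at
  1.\<close>

lemma sum_single_insertion:
  fixes H :: "nat \<Rightarrow> real"
  assumes "H 0 = 0"
  shows "(\<Sum>v\<in>words (Suc (length w)). H (omega w v))
       = sum_runs H (runs w) + (real (length w) + 2 - real (length (runs w))) * H 1"
proof (cases w)
  case Nil
  then show ?thesis by (simp add: sum_words_Suc[where d = True] omega_Nil del: sum_constant)
next
  case (Cons c z)
  obtain q qs where q: "runs (c # z) = q # qs" by (rule runs_ConsE)
  show ?thesis using sum_single_insertion_Cons[where H = H, OF assms q, of 0] q Cons by (simp add: algebra_simps)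
qed

section \<open>Double insertions\<close>

fun run_sum :: "(nat \<Rightarrow> real) \<Rightarrow> nat list \<Rightarrow> real" where
  "run_sum G [] = 0"
| "run_sum G (q # rs) = G ((q + 2) choose 2) + sum_runs (\<lambda>k. G ((q + 1) * k)) rs
     + (real (sum_list rs) + 1 - real (length rs)) * G (q + 1)
     + (real q - 1) * sum_runs G rs + run_sum G rs"

text \<open>Evaluates the alternating part from the run lengths. The argument \<open>l\<close> is the length of the
last run of length at least 2 (if any) plus the number of runs of length 1 following it.\<close>

fun alt_sum :: "(nat \<Rightarrow> real) \<Rightarrow> nat list \<Rightarrow> nat \<Rightarrow> real" where
  "alt_sum G [] l = G (l + 1)"
| "alt_sum G (q # rs) l = (if q = 1 then alt_sum G rs (l + 1)
     else G (q + 1 + l) + (real q - 2) * G (q + 1) + alt_sum G rs q)"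

text \<open>For \<open>e = 0\<close> the argument of \<open>G\<close> is the number of embeddings of \<open>d\<^sup>s y\<close> into \<open>d\<^sup>s v\<close>, obtained by
iterating the recursion of \<open>omega\<close>; the term with \<open>e\<close> carries the embeddings that omit an adjacent
unequal pair further to the left. The \<open>d\<close> prefixed to \<open>y\<close> in the assumption makes \<open>m\<close> the
(possibly zero) number of leading letters \<open>d\<close> of \<open>y\<close>.\<close>

lemma sum_double_insertion_aux:
  fixes G :: "nat \<Rightarrow> real"
  assumes G0: "G 0 = 0" and G1: "G 1 = 0" and "runs (d # y) = Suc m # rs"
  shows "(\<Sum>v\<in>words (length y + 2). G (omega y v + s * omega (d # y) v
            + (s choose 2) * of_bool (v = d # d # y) + e * of_bool (v = (\<not> d) # d # y)))
       = G ((s + m + 2) choose 2) + sum_runs (\<lambda>k. G ((s + m + 1) * k)) rs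
         + (real (sum_list rs) + 1 - real (length rs)) * G (s + m + 1)
         + real m * sum_runs G rs + run_sum G rs
         + (if m = 0 then alt_sum G rs (s + e)
            else G (s + m + 1 + e) + (real m - 1) * G (s + m + 1) + alt_sum G rs (s + m))"
  using assms(3)
proof (induction y arbitrary: d s e m rs)
  case Nil
  then have [simp]: "m = 0" "rs = []" by auto
  have "1 + s * 2 + (s choose 2) = (s + 2) choose 2"
    by (simp add: numeral_2_eq_2)
  then show ?case
    using G1 by (simp add: sum_words_Suc[where d = d] omega_Cons_Cons omega_Nil_right omega_Nil
        eval_nat_numeral add_ac)
next
  case (Cons b y)
  let ?g = "\<lambda>d s e y v. omega y v + s * omega (d # y) v
            + (s choose 2) * of_bool (v = d # d # y) + e * of_bool (v = (\<not> d) # d # y)"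
  let ?k = "length y + 2"
  have k: "?k = Suc (Suc (length y))" by simp
  have split: "(\<Sum>v\<in>words (length (b # y) + 2). G (?g d s e (b # y) v))
      = (\<Sum>v\<in>words ?k. G (?g d s e (b # y) (d # v)))
        + (\<Sum>v\<in>words ?k. G (?g d s e (b # y) ((\<not> d) # v)))"
    using sum_words_Suc[where d = d and k = ?k and f = "\<lambda>v. G (?g d s e (b # y) v)"] by simp
  show ?case
  proof (cases "b = d")
    case True
    obtain q qs where q: "runs (d # y) = q # qs" by (rule runs_ConsE)
    have q': "q = m" "qs = rs" using Cons.prems q True by auto
    have "m \<ge> 1" using runs_pos[of q "d # y"] q q' by simp
    then obtain m' where m: "m = Suc m'" by (cases m) auto
    \<comment> \<open>The coefficients of the word \<open>d # d # y\<close> add up by Pascal's rule.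
      The \<open>e\<close> term vanishes since its word starts with the other letter.\<close>
    have g1: "?g d s e (d # y) (d # v) = ?g d (s + 1) 0 y v" if "v \<in> words ?k" for v
      using that by (auto simp: omega_Cons_Cons omega_same_length eval_nat_numeral)
    have 1: "(\<Sum>v\<in>words ?k. G (?g d s e (d # y) (d # v)))
        = (\<Sum>v\<in>words ?k. G (?g d (s + 1) 0 y v))"
      by (rule sum.cong[OF refl], rule arg_cong[where f = G], rule g1)
    \<comment> \<open>Leaving \<open>y\<close> inside a run uses up one insertion; the
      \<open>s\<close> and \<open>e\<close> terms now sit on the same word.\<close>
    have g2: "?g d s e (d # y) ((\<not> d) # v) = omega (d # y) v + (s + e) * of_bool (v = d # d # y)"
      if "v \<in> words ?k" for v
      using that by (auto simp: omega_Cons_Cons omega_same_length)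
    have 2: "(\<Sum>v\<in>words ?k. G (?g d s e (d # y) ((\<not> d) # v)))
        = (\<Sum>v\<in>words ?k. G (omega (d # y) v + (s + e) * of_bool (v = d # d # y)))"
      by (rule sum.cong[OF refl], rule arg_cong[where f = G], rule g2)
    have 3: "(\<Sum>v\<in>words ?k. G (omega (d # y) v + (s + e) * of_bool (v = d # d # y)))
        = G (m + 1 + (s + e)) + sum_runs G rs"
      using sum_single_insertion_Cons[where H = G, OF G0 q, of "s + e"] G1
      unfolding k q' by simp
    have "runs (d # y) = Suc m' # rs" using q q' m by simp
    note 4 = Cons.IH[OF this, of "s + 1" 0]
    show ?thesis
      unfolding split
      unfolding True 1 2 3 4 by (simp add: m algebra_simps)
  next
    case False
    obtain q rs' where q: "runs (b # y) = q # rs'" by (rule runs_ConsE)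
    have "q \<ge> 1" using runs_pos[of q "b # y"] q by simp
    then obtain m' where m': "q = Suc m'" by (cases q) auto
    have m: "m = 0" "rs = q # rs'" using Cons.prems q False by auto
    have om: "omega (b # y) (d # b # y) = 1"
      using False by (simp add: omega_Cons_Cons omega_same_length omega_eq_0)
    \<comment> \<open>An extra \<open>d\<close> at the end of its run leaves one insertion, scaled
      by \<open>s + 1\<close>. Only a second extra \<open>d\<close> deviates: its count is
      \<open>1 + 2 * s + (s choose 2)\<close>.\<close>
    have g1: "G (?g d s e (b # y) (d # v)) = G ((s + 1) * omega (b # y) v)
        + (if v = d # b # y then G ((s + 2) choose 2) - G (s + 1) else 0)"
      if "v \<in> words ?k" for v
    proof -
      have o1: "omega (b # y) (d # v) = omega (b # y) v"
        using False by (simp add: omega_Cons_Cons)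
      have o2: "omega (d # b # y) (d # v) = of_bool (v = d # b # y) + omega (b # y) v"
        using that by (simp add: omega_Cons_Cons[of d "b # y"] omega_same_length)
      show ?thesis
        unfolding o1 o2 using om by (auto simp: eval_nat_numeral add_ac)
    qed
    have 1: "(\<Sum>v\<in>words ?k. G (?g d s e (b # y) (d # v)))
        = (\<Sum>v\<in>words ?k. G ((s + 1) * omega (b # y) v)) + G ((s + 2) choose 2) - G (s + 1)"
    proof -
      have "(\<Sum>v\<in>words ?k. G (?g d s e (b # y) (d # v))) = (\<Sum>v\<in>words ?k. G ((s + 1) * omega (b # y) v)
        + (if v = d # b # y then G ((s + 2) choose 2) - G (s + 1) else 0))"
        by (rule sum.cong[OF refl], rule g1)
      then show ?thesis by (simp add: sum.distrib finite_words)
    qed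
    have 2: "(\<Sum>v\<in>words ?k. G ((s + 1) * omega (b # y) v))
        = sum_runs (\<lambda>k. G ((s + 1) * k)) rs + (real (length y) + 3 - real (length rs)) * G (s + 1)"
      using sum_single_insertion[where H = "\<lambda>k. G ((s + 1) * k)" and w = "b # y"] G0 m q
      by (simp add: algebra_simps)
    \<comment> \<open>Here \<open>x\<close> follows \<open>y\<close> into the next run. Both the
      \<open>s\<close> and the \<open>e\<close> term end up on \<open>d # b # y\<close>, the word
      with an inserted alternating pair, so \<open>e\<close> becomes \<open>s + e\<close> and
      \<open>s\<close> restarts at 1.\<close>
    have g3: "?g d s e (b # y) ((\<not> d) # v) = ?g b 1 (s + e) y v" if "v \<in> words ?k" for v
      using that False by (auto simp: omega_Cons_Cons omega_same_length algebra_simps)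
    have 3: "(\<Sum>v\<in>words ?k. G (?g d s e (b # y) ((\<not> d) # v)))
        = (\<Sum>v\<in>words ?k. G (?g b 1 (s + e) y v))"
      by (rule sum.cong[OF refl], rule arg_cong[where f = G], rule g3)
    note 4 = Cons.IH[OF q[unfolded m'], of 1 "s + e"]
    have len: "real (length y) = real (sum_list rs) - 1"
      using sum_list_runs[of "b # y"] m q by simp
    show ?thesis
      unfolding split 1 2 3 4 len by (simp add: m m' algebra_simps)
  qed
qed

lemma sum_double_insertion:
  fixes G :: "nat \<Rightarrow> real"
  assumes "G 0 = 0" "G 1 = 0" "y \<noteq> []"
  shows "(\<Sum>v\<in>words (length y + 2). G (omega y v))
       = run_sum G (runs y) + sum_runs G (runs y) + alt_sum G (runs y) 0"
proof -
  obtain d z where y: "y = d # z" using assms by (cases y) auto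
  obtain q rs where q: "runs (d # z) = q # rs" by (rule runs_ConsE)
  have "q \<ge> 1" using runs_pos[of q "d # z"] q by simp
  \<comment> \<open>The prefixed letter is the first letter of \<open>y\<close> itself, so the first
    run allows \<open>q\<close> departures instead of the \<open>q - 1\<close> in
    \<open>run_sum\<close>. This yields the extra \<open>sum_runs\<close>.\<close>
  have "runs (d # y) = Suc q # rs" using q y by simp
  from sum_double_insertion_aux[where G = G, OF assms(1,2) this, of 0 0]
  show ?thesis using q y \<open>q \<ge> 1\<close> by (auto simp: algebra_simps binomial_eq_0)
qed

text \<open>A new first run \<open>q\<close> raises the length by \<open>q\<close> and the number of
  runs by 1, hence every linear coefficient by \<open>q - 1\<close>.\<close>

lemma run_sum_eq:
  "run_sum G rs + sum_runs G rs = (\<Sum>r\<leftarrow>rs. G ((r + 2) choose 2))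
     + (\<Sum>i<length rs. \<Sum>j\<in>{i<..<length rs}. G ((rs ! i + 1) * (rs ! j + 1)))
     + (\<Sum>r\<leftarrow>rs. (real (sum_list rs) + 3 - real (length rs) - real r) * G (r + 1))"
proof (induction rs)
  case (Cons q rs)
  have pairs: "(\<Sum>i<length (q # rs). \<Sum>j\<in>{i<..<length (q # rs)}. G (((q # rs) ! i + 1) * ((q # rs) ! j + 1)))
      = sum_runs (\<lambda>k. G ((q + 1) * k)) rs
        + (\<Sum>i<length rs. \<Sum>j\<in>{i<..<length rs}. G ((rs ! i + 1) * (rs ! j + 1)))"
  proof -
    have "(\<Sum>j\<in>{Suc i<..<Suc (length rs)}. G (a * ((q # rs) ! j + 1)))
        = (\<Sum>j\<in>{i<..<length rs}. G (a * (rs ! j + 1)))" for i a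
      by (rule sum.reindex_bij_witness[of _ Suc "\<lambda>j. j - 1"]) auto
    moreover have "(\<Sum>j\<in>{0<..<Suc (length rs)}. G (a * ((q # rs) ! j + 1)))
        = sum_runs (\<lambda>k. G (a * k)) rs" for a
      unfolding sum_runs_def sum_list_sum_nth
      by (rule sum.reindex_bij_witness[of _ Suc "\<lambda>j. j - 1"]) auto
    ultimately show ?thesis
      by (simp only: list.size add_Suc_right add_0_right sum.lessThan_Suc_shift nth_Cons_0 nth_Cons_Suc)
  qed
  have lin: "(\<Sum>r\<leftarrow>rs. (real (sum_list (q # rs)) + 3 - real (length (q # rs)) - real r) * G (r + 1))
      = (\<Sum>r\<leftarrow>rs. (real (sum_list rs) + 3 - real (length rs) - real r) * G (r + 1))
        + (real q - 1) * sum_runs G rs"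
    unfolding sum_runs_def sum_list_const_mult[symmetric] sum_list_addf[symmetric]
    by (simp add: algebra_simps)
  show ?case using Cons pairs lin by (simp add: algebra_simps)
qed simp

section \<open>From runs to alternating segments\<close>

lemma alts_nonempty: "alts (c # w) \<noteq> []"
  by (induction w arbitrary: c) (auto simp: Let_def)

lemma alts_ConsE:
  obtains a as where "alts (c # w) = a # as"
  using alts_nonempty[of c w] by (cases "alts (c # w)") auto

lemma alts_pos: "a \<in> set (alts w) \<Longrightarrow> a \<ge> 1"
proof (induction w arbitrary: a rule: alts.induct)
  case (3 x z xs)
  obtain b bs where "alts (z # xs) = b # bs" by (rule alts_ConsE)
  then show ?case using 3 by (auto simp: Let_def split: if_splits)
qed auto

text \<open>\<open>next_gap\<close> computes \<open>f\<^sub>i - i\<close> from the segments after the \<open>i\<close>-th; the argument \<open>l\<close> of \<open>seg_sum\<close> is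
\<open>i - b\<^sub>i\<close>. The \<open>i\<close>-th argument of the logarithmic sum is just \<open>1 + a\<^sub>i + f\<^sub>i - b\<^sub>i\<close>, because all
segments strictly between \<open>b\<^sub>i\<close>, \<open>i\<close> and \<open>f\<^sub>i\<close> have length 1.\<close>

fun next_gap :: "nat list \<Rightarrow> nat" where
  "next_gap [] = 0"
| "next_gap (a # as) = (if a > 1 then 1 else Suc (next_gap as))"

fun seg_sum :: "(nat \<Rightarrow> real) \<Rightarrow> nat list \<Rightarrow> nat \<Rightarrow> real" where
  "seg_sum G [] l = 0"
| "seg_sum G (a # as) l = G (1 + a + l + next_gap as) + seg_sum G as (if a > 1 then 1 else Suc l)"

text \<open>All but the last letter of a run of length \<open>m\<close> form segments of length 1.
  The last one opens a longer segment, or ends the word.\<close>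

lemma next_gap_alts: "runs (c # w) = m # rs \<Longrightarrow> next_gap (alts (c # w)) = m"
proof (induction w arbitrary: c m)
  case (Cons b w)
  obtain q qs where q: "runs (b # w) = q # qs" by (rule runs_ConsE)
  obtain a as where a: "alts (b # w) = a # as" by (rule alts_ConsE)
  have "a \<ge> 1" using alts_pos[of a "b # w"] a by simp
  show ?case
  proof (cases "c = b")
    case True
    then show ?thesis using Cons.IH[of b q] Cons.prems q a by auto
  next
    case False
    then show ?thesis using Cons.prems q a \<open>a \<ge> 1\<close> by (auto simp: Let_def)
  qed
qed auto

text \<open>The first part reads \<open>y\<close> after \<open>e\<close> letters of the current alternating segment, the second after
\<open>k\<close> letters of the current run.\<close>

lemma seg_sum_alts_aux:
  "(\<forall>a as e l. alts y = a # as \<longrightarrow> e > 0 \<or> l = 0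
      \<longrightarrow> seg_sum G ((a + e) # as) l = alt_sum G (runs y) (e + l)) \<and>
   (\<forall>m rs k. runs y = m # rs
      \<longrightarrow> seg_sum G (alts y) k = (real m - 1) * G (k + m + 1) + alt_sum G rs (k + m))"
proof (induction y rule: runs.induct)
  case (3 c b w)
  obtain q qs where q: "runs (b # w) = q # qs" by (rule runs_ConsE)
  obtain a as where a: "alts (b # w) = a # as" by (rule alts_ConsE)
  have "q \<ge> 1" using runs_pos[of q "b # w"] q by simp
  have "a \<ge> 1" using alts_pos[of a "b # w"] a by simp
  have IH1: "seg_sum G ((a + e) # as) l = alt_sum G (runs (b # w)) (e + l)"
    if "e > 0 \<or> l = 0" for e l using 3 that a by blast
  have IH2: "seg_sum G (alts (b # w)) k = (real q - 1) * G (k + q + 1) + alt_sum G qs (k + q)"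
    for k using 3 q by blast
  show ?case
  proof (cases "c = b")
    case True
    have al: "alts (c # b # w) = 1 # alts (b # w)" using True by (simp add: Let_def)
    have ru: "runs (c # b # w) = Suc q # qs" using True q by simp
    have gap: "next_gap (alts (b # w)) = q" by (rule next_gap_alts[OF q])
    \<comment> \<open>In the first part, \<open>e > 0 \<or> l = 0\<close> makes the next distance 1
      in either case, so the second part applies with \<open>k = 1\<close>.\<close>
    show ?thesis
      unfolding al ru using \<open>q \<ge> 1\<close> by (auto simp: gap IH2 algebra_simps)
  next
    case False
    have al: "alts (c # b # w) = Suc a # as" using False a by (simp add: Let_def)
    have ru: "runs (c # b # w) = 1 # runs (b # w)" using False by (simp add: Let_def)
    have "seg_sum G (Suc a # as) k = alt_sum G (runs (b # w)) (Suc k)" for k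
      using IH1[of 1 k] by simp
    moreover have "seg_sum G (Suc (a + e) # as) l = alt_sum G (runs (b # w)) (Suc (e + l))" for e l
      using IH1[of "Suc e" l] by simp
    ultimately show ?thesis
      unfolding al ru by (simp del: seg_sum.simps)
  qed
qed auto

lemma seg_sum_alts: "y \<noteq> [] \<Longrightarrow> seg_sum G (alts y) 0 = alt_sum G (runs y) 0"
  using seg_sum_alts_aux[of y G] alts_ConsE by (metis add_0_right neq_Nil_conv)

section \<open>The neighbour indices of a segment\<close>

lemma f_idx_length: "f_idx as (length as) = length as"
  by (auto simp: f_idx_def)

lemma f_idx_step:
  assumes "i < length as"
  shows "f_idx as i = (if idx as (Suc i) > 1 then Suc i else f_idx as (Suc i))"
proof (cases "idx as (Suc i) > 1")
  case True
  then have "\<exists>j. i + 1 \<le> j \<and> j \<le> length as \<and> idx as j > 1" using assms by auto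
  moreover have "(LEAST j. i + 1 \<le> j \<and> j \<le> length as \<and> idx as j > 1) = Suc i"
    by (rule Least_equality) (use True assms in auto)
  ultimately show ?thesis using True by (simp add: f_idx_def)
next
  case False
  have "(i + 1 \<le> j \<and> j \<le> length as \<and> idx as j > 1)
      \<longleftrightarrow> (Suc i + 1 \<le> j \<and> j \<le> length as \<and> idx as j > 1)" for j
    using False by (cases "j = Suc i") auto
  then show ?thesis unfolding f_idx_def by (simp only: False if_False)
qed

lemma f_idx_eq: "i \<le> length as \<Longrightarrow> f_idx as i = i + next_gap (drop i as)"
proof (induction rule: inc_induct)
  case (step i)
  have "drop i as = idx as (Suc i) # drop (Suc i) as"
    using step by (simp add: Cons_nth_drop_Suc idx_def)
  then show ?case using step f_idx_step[of i as] by simp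
qed (simp add: f_idx_length)

lemma f_idx_props: "i \<le> length as \<Longrightarrow>
  i \<le> f_idx as i \<and> f_idx as i \<le> length as \<and> (\<forall>j. i < j \<and> j < f_idx as i \<longrightarrow> idx as j \<le> 1)"
proof (induction rule: inc_induct)
  case (step i)
  then show ?case
    using f_idx_step[of i as] by (auto simp: not_less) (metis Suc_lessI)
qed (simp add: f_idx_length)

lemma b_idx_1: "b_idx as 1 = 1"
  by (auto simp: b_idx_def)

lemma b_idx_step:
  assumes "i \<ge> 1"
  shows "b_idx as (Suc i) = (if idx as i > 1 then i else b_idx as i)"
proof (cases "idx as i > 1")
  case True
  then have "\<exists>j. 1 \<le> j \<and> j \<le> Suc i - 1 \<and> idx as j > 1" using assms by auto
  moreover have "(GREATEST j. 1 \<le> j \<and> j \<le> Suc i - 1 \<and> idx as j > 1) = i"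
    by (rule Greatest_equality) (use True assms in auto)
  ultimately show ?thesis using True by (simp add: b_idx_def)
next
  case False
  have "(1 \<le> j \<and> j \<le> Suc i - 1 \<and> idx as j > 1)
      \<longleftrightarrow> (1 \<le> j \<and> j \<le> i - 1 \<and> idx as j > 1)" for j
    using False by (cases "j = i") auto
  then show ?thesis unfolding b_idx_def by (simp only: False if_False)
qed

lemma b_idx_props: "1 \<le> i \<Longrightarrow>
  1 \<le> b_idx as i \<and> b_idx as i \<le> i \<and> (\<forall>j. b_idx as i < j \<and> j < i \<longrightarrow> idx as j \<le> 1)"
proof (induction i rule: dec_induct)
  case (step i)
  then show ?case
    using b_idx_step[of i as] by (auto simp: not_less less_Suc_eq)
qed (use b_idx_1[of as] in auto)

lemma seg_sum_drop:
  "i \<le> length as \<Longrightarrow> seg_sum G (drop i as) (Suc i - b_idx as (Suc i))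
     = (\<Sum>j=Suc i..length as. G (1 + idx as j + (f_idx as j - b_idx as j)))"
proof (induction rule: inc_induct)
  case (step i)
  have d: "drop i as = idx as (Suc i) # drop (Suc i) as"
    using step by (simp add: Cons_nth_drop_Suc idx_def)
  have b: "b_idx as (Suc i) \<le> Suc i" using b_idx_props[of "Suc i" as] by simp
  have f: "f_idx as (Suc i) = Suc i + next_gap (drop (Suc i) as)"
    using f_idx_eq[of "Suc i" as] step by simp
  \<comment> \<open>The update of the distance in \<open>seg_sum\<close> is the recursion of
    \<open>b_idx\<close>.\<close>
  have l: "(if idx as (Suc i) > 1 then 1 else Suc (Suc i - b_idx as (Suc i)))
      = Suc (Suc i) - b_idx as (Suc (Suc i))"
    using b_idx_step[of "Suc i" as] b by auto
  have t: "Suc i - b_idx as (Suc i) + next_gap (drop (Suc i) as)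
      = f_idx as (Suc i) - b_idx as (Suc i)"
    using b f by simp
  have "{Suc i..length as} = insert (Suc i) {Suc (Suc i)..length as}" using step by auto
  then show ?case
    unfolding d seg_sum.simps l using step.IH t by (simp add: add.assoc)
qed simp

text \<open>After the subtractions every segment of the window other than the \<open>i\<close>-th
  counts 1, so these contribute \<open>f - b\<close> in total.\<close>

lemma sum_segment_window:
  fixes a :: "nat \<Rightarrow> nat"
  assumes "b \<le> i" "i \<le> f"
    and left: "\<And>j. b < j \<Longrightarrow> j < i \<Longrightarrow> a j = 1"
    and right: "\<And>j. i < j \<Longrightarrow> j < f \<Longrightarrow> a j = 1"
  shows "(\<Sum>j=b..f. real (a j)) - (if b \<noteq> i then real (a b) - 1 else 0)
      - (if f \<noteq> i then real (a f) - 1 else 0) = real (a i + (f - b))"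
proof -
  have "(\<Sum>j=b..f. real (a j)) = (\<Sum>j\<in>{b..<i}. real (a j)) + (\<Sum>j\<in>{i..<f}. real (a j)) + real (a f)"
    using assms(1,2) by (simp add: sum.atLeastLessThan_concat sum.last_plus atLeastLessThanSuc_atLeastAtMost[symmetric])
  moreover have "(\<Sum>j\<in>{b..<i}. real (a j)) - (if b \<noteq> i then real (a b) - 1 else 0) = real (i - b)"
  proof (cases "b = i")
    case False
    then have "b < i" using assms by simp
    then have "(\<Sum>j\<in>{b..<i}. real (a j)) = real (a b) + (\<Sum>j\<in>{Suc b..<i}. real (a j))"
      by (simp add: sum.atLeast_Suc_lessThan)
    also have "(\<Sum>j\<in>{Suc b..<i}. real (a j)) = (\<Sum>j\<in>{Suc b..<i}. 1)"
      using left by (intro sum.cong) auto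
    finally show ?thesis using \<open>b < i\<close> by simp
  qed simp
  moreover have "(\<Sum>j\<in>{i..<f}. real (a j)) + real (a f) - (if f \<noteq> i then real (a f) - 1 else 0)
      = real (a i) + real (f - i)"
  proof (cases "f = i")
    case False
    then have "i < f" using assms by simp
    then have "(\<Sum>j\<in>{i..<f}. real (a j)) = real (a i) + (\<Sum>j\<in>{Suc i..<f}. real (a j))"
      by (simp add: sum.atLeast_Suc_lessThan)
    also have "(\<Sum>j\<in>{Suc i..<f}. real (a j)) = (\<Sum>j\<in>{Suc i..<f}. 1)"
      using right by (intro sum.cong) auto
    finally show ?thesis using \<open>i < f\<close> by simp
  qed simp
  ultimately show ?thesis using assms(1,2) by simp
qed

lemma sum_segments:
  assumes pos: "\<forall>x\<in>set as. x \<ge> 1"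
  shows "(\<Sum>i=1..length as. F (1 + (\<Sum>j=b_idx as i..f_idx as i. real (idx as j))
            - (if b_idx as i \<noteq> i then real (idx as (b_idx as i)) - 1 else 0)
            - (if f_idx as i \<noteq> i then real (idx as (f_idx as i)) - 1 else 0)))
       = seg_sum (\<lambda>k. F (real k)) as 0"
proof -
  have "1 + (\<Sum>j=b_idx as i..f_idx as i. real (idx as j))
            - (if b_idx as i \<noteq> i then real (idx as (b_idx as i)) - 1 else 0)
            - (if f_idx as i \<noteq> i then real (idx as (f_idx as i)) - 1 else 0)
      = real (1 + idx as i + (f_idx as i - b_idx as i))" if i: "i \<in> {1..length as}" for i
  proof -
    have one: "idx as j = 1" if "idx as j \<le> 1" "1 \<le> j" "j \<le> length as" for j
      using bspec[OF pos, of "idx as j"] that by (auto simp: idx_def)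
    note b = b_idx_props[of i as] and f = f_idx_props[of i as]
    have "(\<Sum>j=b_idx as i..f_idx as i. real (idx as j))
            - (if b_idx as i \<noteq> i then real (idx as (b_idx as i)) - 1 else 0)
            - (if f_idx as i \<noteq> i then real (idx as (f_idx as i)) - 1 else 0)
      = real (idx as i + (f_idx as i - b_idx as i))"
      by (rule sum_segment_window) (use b f i one in auto)
    then show ?thesis by simp
  qed
  then have "(\<Sum>i=1..length as. F (1 + (\<Sum>j=b_idx as i..f_idx as i. real (idx as j))
            - (if b_idx as i \<noteq> i then real (idx as (b_idx as i)) - 1 else 0)
            - (if f_idx as i \<noteq> i then real (idx as (f_idx as i)) - 1 else 0)))
       = (\<Sum>i=1..length as. F (real (1 + idx as i + (f_idx as i - b_idx as i))))"
    by (intro sum.cong refl arg_cong[where f = F])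
  then show ?thesis using seg_sum_drop[of 0 as "\<lambda>k. F (real k)"] b_idx_1[of as] by simp
qed

section \<open>Entropy and the final formula\<close>

text \<open>The channel factor cancels in the posterior, leaving \<open>omega y x / N\<close> with
  \<open>N\<close> the total number of embeddings; the logarithm of the quotient then
  splits.\<close>

lemma H_in_del_eq:
  assumes "length y + k = n"
  defines "N \<equiv> real (n choose k) * 2 ^ k"
  shows "H_in_del n k y = log 2 N - W n y / N"
proof -
  have "k \<le> n" using assms by simp
  then have c: "real (n choose k) > 0" and N: "N > 0" by (auto simp: N_def)
  have sum: "(\<Sum>x\<in>words n. real (omega y x)) = N"
    using sum_omega[of y k] assms(1) unfolding N_def of_nat_sum[symmetric] by simp
  have "(\<Sum>x\<in>words n. del_prob n k x y) = N / real (n choose k)"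
    unfolding del_prob_def sum_divide_distrib[symmetric] sum ..
  then have post: "posterior n k y x = real (omega y x) / N" for x
    using c by (simp add: posterior_def del_prob_def)
  have "(if posterior n k y x = 0 then 0 else posterior n k y x * log 2 (posterior n k y x))
      = (if omega y x = 0 then 0 else F (real (omega y x))) / N - real (omega y x) * (log 2 N / N)" for x
    using N by (auto simp: post F_def log_divide field_simps)
  then have "H_in_del n k y = - (W n y / N - N * (log 2 N / N))"
    unfolding H_in_del_def W_def
    by (simp only: sum_subtractf sum_divide_distrib[symmetric] sum_distrib_right[symmetric] sum)
  then show ?thesis using N by simp
qed

lemma sum_list_idx: "(\<Sum>i=1..length l. f (idx l i)) = (\<Sum>x\<leftarrow>l. f x)"
  unfolding sum_list_sum_nth
  by (rule sum.reindex_bij_witness[of _ Suc "\<lambda>i. i - 1"]) (auto simp: idx_def)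

lemma sum_pairs_idx:
  "(\<Sum>i=1..length l. \<Sum>j=i+1..length l. f (idx l i) (idx l j))
   = (\<Sum>i<length l. \<Sum>j\<in>{i<..<length l}. f (l ! i) (l ! j))"
proof -
  have "(\<Sum>j=i+1..length l. f (idx l i) (idx l j)) = (\<Sum>j\<in>{i-1<..<length l}. f (l ! (i - 1)) (l ! j))"
    if "i \<ge> 1" for i
    by (rule sum.reindex_bij_witness[of _ Suc "\<lambda>i. i - 1"]) (use that in \<open>auto simp: idx_def\<close>)
  then show ?thesis
    by (intro sum.reindex_bij_witness[where i = Suc and j = "\<lambda>i. i - 1"
          and S = "{1..length l}" and T = "{..<length l}"]) auto
qed

theorem theorem3:
  fixes n :: nat and y :: "bool list"
  assumes "n \<ge> 3" and "length y = n - 2"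
  shows "H_in_del n 2 y = log 2 (2 * real n * (real n - 1)) - W n y / (2 * real n * (real n - 1))
       \<and> W n y =
           (let rs = runs y; R = length rs; r = idx rs;
                as = alts y; A = length as; a = idx as;
                f = f_idx as; b = b_idx as
            in (\<Sum>i=1..R. F (real ((r i + 2) choose 2)))
             + (\<Sum>i=1..R. \<Sum>j=i+1..R. F (real ((r i + 1) * (r j + 1))))
             + (\<Sum>i=1..R. (real n + 1 - real R - real (r i)) * F (real (r i + 1)))
             + (\<Sum>i=1..A. F (1 + (\<Sum>j=b i..f i. real (a j))
                               - (if b i \<noteq> i then real (a (b i)) - 1 else 0)
                               - (if f i \<noteq> i then real (a (f i)) - 1 else 0))))"
proof
  have len: "length y + 2 = n" and "y \<noteq> []" using assms by auto
  have pos: "\<forall>x\<in>set (alts y). x \<ge> 1" using alts_pos by blast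
  have len3: "real (length y) + 3 = real n + 1" using len by auto
  have "real (n choose 2) * 2 ^ 2 = 2 * real n * (real n - 1)"
  proof -
    \<comment> \<open>Parity removes the truncated division in \<open>choose_two\<close>.\<close>
    have "even (n * (n - 1))" by (cases "even n") auto
    then have "2 * (n choose 2) = n * (n - 1)" by (simp add: choose_two)
    then have "2 * real (n choose 2) = real n * real (n - 1)"
      by (metis of_nat_mult of_nat_numeral)
    then show ?thesis using assms by simp
  qed
  then show "H_in_del n 2 y = log 2 (2 * real n * (real n - 1)) - W n y / (2 * real n * (real n - 1))"
    using H_in_del_eq[OF len] by (simp only:)
  let ?G = "\<lambda>k. F (real k)"
  \<comment> \<open>As \<open>F 0 = 0\<close>, the omitted terms can be restored.\<close>
  have "W n y = (\<Sum>v\<in>words (length y + 2). ?G (omega y v))"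
    unfolding W_def len by (intro sum.cong) (auto simp: F_def)
  also have "\<dots> = run_sum ?G (runs y) + sum_runs ?G (runs y) + alt_sum ?G (runs y) 0"
    by (rule sum_double_insertion) (use \<open>y \<noteq> []\<close> in \<open>auto simp: F_def\<close>)
  also have "alt_sum ?G (runs y) 0 = seg_sum ?G (alts y) 0"
    by (rule seg_sum_alts[OF \<open>y \<noteq> []\<close>, symmetric])
  finally have "W n y = (\<Sum>r\<leftarrow>runs y. ?G ((r + 2) choose 2))
     + (\<Sum>i<length (runs y). \<Sum>j\<in>{i<..<length (runs y)}. ?G ((runs y ! i + 1) * (runs y ! j + 1)))
     + (\<Sum>r\<leftarrow>runs y. (real n + 1 - real (length (runs y)) - real r) * ?G (r + 1))
     + seg_sum ?G (alts y) 0"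
    unfolding run_sum_eq sum_list_runs len3 .
  then show "W n y =
           (let rs = runs y; R = length rs; r = idx rs;
                as = alts y; A = length as; a = idx as;
                f = f_idx as; b = b_idx as
            in (\<Sum>i=1..R. F (real ((r i + 2) choose 2)))
             + (\<Sum>i=1..R. \<Sum>j=i+1..R. F (real ((r i + 1) * (r j + 1))))
             + (\<Sum>i=1..R. (real n + 1 - real R - real (r i)) * F (real (r i + 1)))
             + (\<Sum>i=1..A. F (1 + (\<Sum>j=b i..f i. real (a j))
                               - (if b i \<noteq> i then real (a (b i)) - 1 else 0)
                               - (if f i \<noteq> i then real (a (f i)) - 1 else 0))))"
    unfolding Let_def sum_segments[OF pos]
      sum_list_idx[where f = "\<lambda>r. F (real ((r + 2) choose 2))"]
      sum_list_idx[where f = "\<lambda>q. (real n + 1 - real (length (runs y)) - real q) * F (real (q + 1))"]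
      sum_pairs_idx[where f = "\<lambda>q r. F (real ((q + 1) * (r + 1)))"] .
qed

end
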